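(* For every non-decidable r.e. set $A\subseteq\mathbb{N}$, there are infinitely many type-2 uniformity equivalence classes that are subsets of the Turing-reducibility equivalence class $[A]_T$.
   Context: $\mathbb{N}=\{1,2,3,\dots\}$. $[A]_T$ is the collection of sets Turing equivalent to $A$. A listing of an infinite r.e. set $A\subseteq\mathbb{N}$ is a total computable bijection $h:\mathbb{N}\to A$. Two listings $h,g$ are uniform, $h\sim g$, if $h(i)<h(j)\Leftrightarrow g(i)<g(j)$ for all $i,j\in\mathbb{N}$. Two infinite r.e. sets $A,B$ are uniform, $A\sim B$, if there exist a listing $h$ of $A$ and a listing $g$ of $B$ with $h\sim g$. Two sets $A,A'$ are almost equal, $A\approx A'$, if $(A-A')\cup(A'-A)$ is finite. Two sets $A,B$ are type-2 uniform, $A\sim_2 B$, if there exist sets $A',B'$ with $A\approx A'$, $B\approx B'$ and $A'\sim B'$. The type-2 uniformity equivalence class of an r.e. set $B$ is $[B]_{\sim_2}=\{C\subseteq\mathbb{N}: B\sim_2 C\}$. *)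

theory Defs
  imports Main
begin

section \<open>Oracle computability\<close>

text \<open>
  Partial recursive functions relative to an oracle set, in Kleene's presentation. Programs carry no
  arity annotation: for each \<open>k\<close>, a program denotes a partial function on the lists of length \<open>k\<close>,
  and an ill-formed application such as \<open>Proj i\<close> with \<open>i \<ge> k\<close> is simply undefined.
\<close>

datatype prog =
    Zero
  | Succ
  | Proj nat
  | Query
  | Comp prog "prog list"
  | PrimRec prog prog
  | Mu prog

inductive eval :: "nat set \<Rightarrow> prog \<Rightarrow> nat list \<Rightarrow> nat \<Rightarrow> bool" for X :: "nat set" where
  Zero: "eval X Zero xs 0"
| Succ: "eval X Succ [x] (Suc x)"
| Proj: "i < length xs \<Longrightarrow> eval X (Proj i) xs (xs ! i)"
| Query: "eval X Query [x] (if x \<in> X then 1 else 0)"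
| Comp: "list_all2 (\<lambda>g y. eval X g xs y) gs ys \<Longrightarrow> eval X f ys z \<Longrightarrow> eval X (Comp f gs) xs z"
| PrimRec_0: "eval X f xs y \<Longrightarrow> eval X (PrimRec f g) (0 # xs) y"
| PrimRec_Suc: "eval X (PrimRec f g) (n # xs) r \<Longrightarrow> eval X g (n # r # xs) y
    \<Longrightarrow> eval X (PrimRec f g) (Suc n # xs) y"
| Mu: "eval X f (n # xs) 0 \<Longrightarrow> (\<And>i. i < n \<Longrightarrow> \<exists>y>0. eval X f (i # xs) y)
    \<Longrightarrow> eval X (Mu f) xs n"

lemma eval_deterministic: "eval X p xs y \<Longrightarrow> eval X p xs z \<Longrightarrow> y = z"
proof (induction arbitrary: z rule: eval.induct)
  case (Comp xs gs ys f w)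
  from Comp.prems obtain ys' where ys': "list_all2 (\<lambda>g y. eval X g xs y) gs ys'" "eval X f ys' z"
    by (cases rule: eval.cases) auto
  have "ys = ys'"
    using Comp.IH(1) ys'(1) by (auto simp: list_all2_conv_all_nth intro!: nth_equalityI)
  then show ?case using Comp.IH(2) ys'(2) by simp
next
  case (PrimRec_0 f xs y g)
  from PrimRec_0.prems show ?case by (cases rule: eval.cases) (use PrimRec_0.IH in auto)
next
  case (PrimRec_Suc f g n xs r y)
  from PrimRec_Suc.prems show ?case by (cases rule: eval.cases) (use PrimRec_Suc.IH in auto)
next
  case (Mu f n xs)
  from Mu.prems have z: "eval X f (z # xs) 0" "\<And>i. i < z \<Longrightarrow> \<exists>y>0. eval X f (i # xs) y"
    by (cases rule: eval.cases; auto)+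
  show ?case
  proof (rule linorder_cases[of n z])
    assume "n < z"
    then show ?thesis using Mu.IH(1) z(2) by fastforce
  next
    assume "z < n"
    then show ?thesis using Mu.IH(2) z(1) by fastforce
  qed
qed (auto elim: eval.cases)

text \<open>The sets and listings considered live on the positive integers; 0 is only used internally by programs.\<close>

abbreviation pnat :: "nat set" where
  "pnat \<equiv> {1..}"

definition computable_in :: "nat set \<Rightarrow> (nat \<Rightarrow> nat) \<Rightarrow> bool" where
  "computable_in X f \<longleftrightarrow> (\<exists>p. \<forall>x\<in>pnat. eval X p [x] (f x))"

text \<open>An empty oracle answers every query with 0, so it adds nothing to oracle-free computation.\<close>

abbreviation computable :: "(nat \<Rightarrow> nat) \<Rightarrow> bool" where
  "computable \<equiv> computable_in {}"

definition char_fun :: "nat set \<Rightarrow> nat \<Rightarrow> nat" where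
  "char_fun A x = (if x \<in> A then 1 else 0)"

definition decidable :: "nat set \<Rightarrow> bool" where
  "decidable A \<longleftrightarrow> computable (char_fun A)"

text \<open>Recursively enumerable sets as domains of partial computable functions.\<close>

definition re :: "nat set \<Rightarrow> bool" where
  "re A \<longleftrightarrow> A \<subseteq> pnat \<and> (\<exists>p. A = {x \<in> pnat. \<exists>y. eval {} p [x] y})"

definition turing_le :: "nat set \<Rightarrow> nat set \<Rightarrow> bool"  (infix "\<le>\<^sub>T" 50) where
  "A \<le>\<^sub>T B \<longleftrightarrow> computable_in B (char_fun A)"

definition turing_class :: "nat set \<Rightarrow> nat set set" where
  "turing_class A = {B. B \<subseteq> pnat \<and> A \<le>\<^sub>T B \<and> B \<le>\<^sub>T A}"


section \<open>Uniformity\<close>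

definition listing :: "(nat \<Rightarrow> nat) \<Rightarrow> nat set \<Rightarrow> bool" where
  "listing h A \<longleftrightarrow> infinite A \<and> re A \<and> computable h \<and> bij_betw h pnat A"

definition uniform_listings :: "(nat \<Rightarrow> nat) \<Rightarrow> (nat \<Rightarrow> nat) \<Rightarrow> bool" where
  "uniform_listings h g \<longleftrightarrow> (\<forall>i\<in>pnat. \<forall>j\<in>pnat. h i < h j \<longleftrightarrow> g i < g j)"

definition uniform :: "nat set \<Rightarrow> nat set \<Rightarrow> bool"  (infix "\<sim>" 50) where
  "A \<sim> B \<longleftrightarrow> (\<exists>h g. listing h A \<and> listing g B \<and> uniform_listings h g)"

definition almost_equal :: "nat set \<Rightarrow> nat set \<Rightarrow> bool"  (infix "\<approx>" 50) where
  "A \<approx> A' \<longleftrightarrow> finite ((A - A') \<union> (A' - A))"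

definition type2_uniform :: "nat set \<Rightarrow> nat set \<Rightarrow> bool"  (infix "\<sim>\<^sub>2" 50) where
  "A \<sim>\<^sub>2 B \<longleftrightarrow> (\<exists>A' B'. A \<approx> A' \<and> B \<approx> B' \<and> A' \<sim> B')"

definition type2_class :: "nat set \<Rightarrow> nat set set" where
  "type2_class B = {C. C \<subseteq> pnat \<and> B \<sim>\<^sub>2 C}"

text \<open>
  Uniformity relates infinite sets only, so \<open>type2_class B\<close> is empty for finite \<open>B\<close>; the
  restriction to infinite \<open>B\<close> leaves out exactly this degenerate value.
\<close>

definition type2_classes :: "nat set set set" where
  "type2_classes = {type2_class B | B. re B \<and> infinite B}"

end

theory Submission
  imports Defs "HOL-Library.Infinite_Set"
begin

text \<open>
  For \<open>L \<ge> 2\<close> let \<open>B\<^sub>L\<close> consist of all positive multiples of \<open>L\<close> together with the \<open>L - 1\<close> numbers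
  following \<open>L x\<close>, for each \<open>x \<in> A\<close>. Every \<open>B\<^sub>L\<close> is recursively enumerable and Turing equivalent to
  \<open>A\<close>, and type-2 uniformity preserves Turing degrees. If \<open>B\<^sub>M\<close> and \<open>B\<^sub>L\<close> with \<open>M \<noteq> L\<close> were type-2
  uniform, then for large \<open>x\<close> one could compute the elements \<open>u < v\<close> of \<open>B\<^sub>L\<close> that correspond to the
  elements \<open>M x\<close> and \<open>M (x + 1)\<close> of \<open>B\<^sub>M\<close>. The interval from \<open>u\<close> to \<open>v\<close> contains \<open>M\<close> elements of \<open>B\<^sub>L\<close>
  if \<open>x \<in> A\<close> and just one otherwise, and the latter happens exactly when \<open>v\<close> is \<open>u + 1\<close> or
  \<open>u + L\<close>. This would decide \<open>A\<close>.
\<close>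

section \<open>Closure properties of computable functions\<close>

text \<open>The argument of a computable function is an environment \<open>e\<close> of variables, of which a program
  reads the first \<open>k\<close>. No arity has to be tracked, and binding a variable shifts the environment.\<close>

definition cfn :: "nat set \<Rightarrow> ((nat \<Rightarrow> nat) \<Rightarrow> nat) \<Rightarrow> bool" where
  "cfn X F \<longleftrightarrow> (\<exists>p k. \<forall>e. eval X p (map e [0..<k]) (F e))"

definition cpred :: "nat set \<Rightarrow> ((nat \<Rightarrow> nat) \<Rightarrow> bool) \<Rightarrow> bool" where
  "cpred X P \<longleftrightarrow> cfn X (\<lambda>e. if P e then 1 else 0)"

lemma eval_Comp_map:
  assumes "\<And>i. i < n \<Longrightarrow> eval X (q i) xs (y i)" and "eval X f (map y [0..<n]) z"
  shows "eval X (Comp f (map q [0..<n])) xs z"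
  by (rule eval.Comp[OF _ assms(2)]) (use assms(1) in \<open>auto simp: list_all2_conv_all_nth\<close>)

lemma eval_Comp1: "eval X q xs y \<Longrightarrow> eval X f [y] z \<Longrightarrow> eval X (Comp f [q]) xs z"
  by (rule eval.Comp[where ys = "[y]"]) auto

text \<open>A program that reads \<open>k\<close> variables also works on a longer prefix, after
  projecting to the first \<open>k\<close>. Stating this for all large \<open>K\<close> lets
  finitely many functions share one \<open>K\<close>.\<close>

lemma cfn_eventually:
  "cfn X F \<longleftrightarrow> (\<forall>\<^sub>F K in sequentially. \<exists>p. \<forall>e. eval X p (map e [0..<K]) (F e))"
proof
  assume "cfn X F"
  then obtain p k where p: "\<And>e. eval X p (map e [0..<k]) (F e)" unfolding cfn_def by auto
  have "eval X (Comp p (map Proj [0..<k])) (map e [0..<K]) (F e)" if "k \<le> K" for K e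
    by (rule eval_Comp_map[OF _ p]) (use that eval.Proj[of _ "map e [0..<K]" X] in auto)
  then show "\<forall>\<^sub>F K in sequentially. \<exists>p. \<forall>e. eval X p (map e [0..<K]) (F e)"
    unfolding eventually_sequentially by blast
next
  assume "\<forall>\<^sub>F K in sequentially. \<exists>p. \<forall>e. eval X p (map e [0..<K]) (F e)"
  then show "cfn X F"
    unfolding cfn_def by (auto dest!: eventually_happens)
qed

text \<open>\<open>F\<close> reads finitely many variables, so only finitely many \<open>G i\<close>
  matter, and these have a common prefix length.\<close>

lemma cfn_substitute:
  assumes F: "cfn X F" and G: "\<And>i. cfn X (G i)"
  shows "cfn X (\<lambda>e. F (\<lambda>i. G i e))"
proof -
  obtain p k where p: "\<And>e. eval X p (map e [0..<k]) (F e)" using F unfolding cfn_def by auto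
  have "\<forall>\<^sub>F K in sequentially. \<forall>i\<in>{..<k}. \<exists>q. \<forall>e. eval X q (map e [0..<K]) (G i e)"
    using G by (simp add: eventually_ball_finite_distrib cfn_eventually)
  then obtain K where "\<forall>i\<in>{..<k}. \<exists>q. \<forall>e. eval X q (map e [0..<K]) (G i e)"
    by (auto simp: eventually_sequentially)
  then obtain q where q: "\<And>i e. i < k \<Longrightarrow> eval X (q i) (map e [0..<K]) (G i e)"
    by (metis lessThan_iff)
  have "eval X (Comp p (map q [0..<k])) (map e [0..<K]) (F (\<lambda>i. G i e))" for e
    by (rule eval_Comp_map[OF q p])
  then show ?thesis unfolding cfn_def by blast
qed

lemma cfn_substitute1:
  "cfn X (\<lambda>e. f (e 0)) \<Longrightarrow> cfn X G \<Longrightarrow> cfn X (\<lambda>e. f (G e))"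
  using cfn_substitute[of X "\<lambda>e. f (e 0)" "\<lambda>i. G"] by simp

lemma cfn_substitute2:
  assumes "cfn X (\<lambda>e. f (e 0) (e 1))" "cfn X G" "cfn X H"
  shows "cfn X (\<lambda>e. f (G e) (H e))"
  using cfn_substitute[of X "\<lambda>e. f (e 0) (e 1)" "\<lambda>i. if i = 0 then G else H"] assms by simp

lemma cfn_var: "cfn X (\<lambda>e. e i)"
  unfolding cfn_def
  by (intro exI[of _ "Proj i"] exI[of _ "Suc i"])
    (use eval.Proj[of i "map _ [0..<Suc i]" X] in \<open>auto simp del: upt_Suc\<close>)

lemma cfn_Suc: "cfn X F \<Longrightarrow> cfn X (\<lambda>e. Suc (F e))"
proof (rule cfn_substitute1[where f = Suc])
  show "cfn X (\<lambda>e. Suc (e 0))" unfolding cfn_def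
    by (intro exI[of _ Succ] exI[of _ 1]) (auto intro: eval.Succ)
qed

lemma cfn_const: "cfn X (\<lambda>e. c)"
proof (induction c)
  case 0
  then show ?case unfolding cfn_def by (blast intro: eval.Zero)
qed (rule cfn_Suc)

text \<open>The counter and the previous value become variables 0 and 1, in the argument order of
  \<open>PrimRec\<close>; the outer environment is shifted by two.\<close>

lemma cfn_rec_nat:
  assumes "cfn X a" "cfn X (\<lambda>e. b (e 0) (e (Suc 0)) (\<lambda>i. e (Suc (Suc i))))" "cfn X n"
  shows "cfn X (\<lambda>e. rec_nat (a e) (\<lambda>i r. b i r e) (n e))"
proof -
  obtain k where k: "\<And>K. k \<le> K \<Longrightarrow> \<exists>p. \<forall>e. eval X p (map e [0..<K]) (a e)"
    using assms(1) by (auto simp: cfn_eventually eventually_sequentially)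
  obtain l where l: "\<And>K. l \<le> K \<Longrightarrow>
      \<exists>q. \<forall>e. eval X q (map e [0..<K]) (b (e 0) (e (Suc 0)) (\<lambda>i. e (Suc (Suc i))))"
    using assms(2) by (auto simp: cfn_eventually eventually_sequentially)
  define K where "K = max k l"
  obtain p where p: "\<And>e. eval X p (map e [0..<K]) (a e)"
    using k[of K] by (auto simp: K_def)
  obtain q where
    q: "\<And>e. eval X q (map e [0..<Suc (Suc K)]) (b (e 0) (e (Suc 0)) (\<lambda>i. e (Suc (Suc i))))"
    using l[OF le_SucI[OF le_SucI[OF max.cobounded2[of l k]]]] unfolding K_def by blast
  have "eval X (PrimRec p q) (m # map e [0..<K]) (rec_nat (a e) (\<lambda>i r. b i r e) m)" for m e
  proof (induction m)
    case (Suc m)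
    have "eval X q (m # rec_nat (a e) (\<lambda>i r. b i r e) m # map e [0..<K])
        (b m (rec_nat (a e) (\<lambda>i r. b i r e) m) e)"
      using q[of "case_nat m (case_nat (rec_nat (a e) (\<lambda>i r. b i r e) m) e)"]
      by (simp add: map_upt_Suc del: upt_Suc)
    with Suc show ?case by (auto intro: eval.PrimRec_Suc)
  qed (auto intro: eval.PrimRec_0 p)
  then have "eval X (PrimRec p q) (map e [0..<Suc K])
      (rec_nat (a (\<lambda>i. e (Suc i))) (\<lambda>i r. b i r (\<lambda>i. e (Suc i))) (e 0))" for e
    by (simp add: map_upt_Suc del: upt_Suc)
  then have "cfn X (\<lambda>e. rec_nat (a (\<lambda>i. e (Suc i))) (\<lambda>i r. b i r (\<lambda>i. e (Suc i))) (e 0))"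
    unfolding cfn_def by blast
  \<comment> \<open>The recursion was built with variable 0 as its counter; putting \<open>n\<close>
    there and \<open>e i\<close> at position \<open>Suc i\<close> undoes the shift.\<close>
  moreover have "cfn X (case_nat n (\<lambda>i e. e i) i)" for i
    by (cases i) (auto intro: assms cfn_var)
  ultimately show ?thesis
    by (drule_tac cfn_substitute[where G = "case_nat n (\<lambda>i e. e i)"]) simp_all
qed


section \<open>Arithmetic and Boolean operations\<close>

lemma cfn_add: "cfn X F \<Longrightarrow> cfn X G \<Longrightarrow> cfn X (\<lambda>e. F e + G e)"
proof -
  assume *: "cfn X F" "cfn X G"
  have "rec_nat m (\<lambda>i r. Suc r) n = m + n" for m n by (induction n) auto
  with cfn_rec_nat[OF *(1) _ *(2), of "\<lambda>i r e. Suc r"] show ?thesis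
    by (simp add: cfn_Suc cfn_var)
qed

lemma cfn_diff: "cfn X F \<Longrightarrow> cfn X G \<Longrightarrow> cfn X (\<lambda>e. F e - G e)"
proof -
  assume *: "cfn X F" "cfn X G"
  \<comment> \<open>Returning the counter yields the predecessor, truncated at 0; iterating that
    gives truncated subtraction.\<close>
  have "rec_nat 0 (\<lambda>i r. i) n = n - 1" for n by (cases n) auto
  then have "cfn X (\<lambda>e. e 0 - 1)"
    using cfn_rec_nat[of X "\<lambda>e. 0" "\<lambda>i r e. i" "\<lambda>e. e 0"] by (simp add: cfn_const cfn_var)
  then have pred: "cfn X (\<lambda>e. e i - 1)" for i
    by (rule cfn_substitute1[OF _ cfn_var])
  have "rec_nat m (\<lambda>i r. r - 1) n = m - n" for m n by (induction n) auto
  with cfn_rec_nat[OF *(1) _ *(2), of "\<lambda>i r e. r - 1"] pred show ?thesis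
    by simp
qed

lemma cfn_mult: "cfn X F \<Longrightarrow> cfn X G \<Longrightarrow> cfn X (\<lambda>e. F e * G e)"
proof -
  assume *: "cfn X F" "cfn X G"
  have "rec_nat 0 (\<lambda>i r. r + m) n = m * n" for m n :: nat by (induction n) auto
  moreover have "cfn X (\<lambda>e. F (\<lambda>i. e (Suc (Suc i))))"
    by (rule cfn_substitute[OF *(1) cfn_var])
  ultimately show ?thesis
    using cfn_rec_nat[OF cfn_const _ *(2), of "\<lambda>i r e. r + F e" 0]
    by (simp add: cfn_add cfn_var)
qed

lemma cpred_eq_0: "cfn X F \<Longrightarrow> cpred X (\<lambda>e. F e = 0)"
proof -
  assume "cfn X F"
  moreover have "(if n = 0 then 1 else 0) = 1 - n" for n :: nat by auto
  ultimately show ?thesis unfolding cpred_def by (simp add: cfn_diff cfn_const)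
qed

lemma cpred_conj:
  assumes "cpred X P" "cpred X Q"
  shows "cpred X (\<lambda>e. P e \<and> Q e)"
proof -
  have "cfn X (\<lambda>e. (if P e then 1 else 0) * (if Q e then 1 else 0))"
    using assms unfolding cpred_def by (rule cfn_mult)
  moreover have "(if P e then 1 else 0) * (if Q e then 1 else 0)
      = (if P e \<and> Q e then 1 else (0::nat))" for e by simp
  ultimately show ?thesis unfolding cpred_def by (simp only:)
qed

lemma cpred_not: "cpred X P \<Longrightarrow> cpred X (\<lambda>e. \<not> P e)"
proof -
  assume "cpred X P"
  then have "cpred X (\<lambda>e. (if P e then 1 else 0) = (0::nat))"
    unfolding cpred_def[of X P] by (rule cpred_eq_0)
  moreover have "(if P e then 1 else 0) = (0::nat) \<longleftrightarrow> \<not> P e" for e by simp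
  ultimately show ?thesis by (simp only:)
qed

lemma cpred_disj: "cpred X P \<Longrightarrow> cpred X Q \<Longrightarrow> cpred X (\<lambda>e. P e \<or> Q e)"
  using cpred_not[OF cpred_conj[OF cpred_not cpred_not], of X P Q] by simp

lemma cpred_le: "cfn X F \<Longrightarrow> cfn X G \<Longrightarrow> cpred X (\<lambda>e. F e \<le> G e)"
  using cpred_eq_0[OF cfn_diff, of X F G] by simp

lemma cpred_less: "cfn X F \<Longrightarrow> cfn X G \<Longrightarrow> cpred X (\<lambda>e. F e < G e)"
  using cpred_le[OF cfn_Suc, of X F G] by (simp add: Suc_le_eq)

lemma cpred_eq: "cfn X F \<Longrightarrow> cfn X G \<Longrightarrow> cpred X (\<lambda>e. F e = G e)"
  using cpred_conj[OF cpred_le cpred_le, of X F G G F] by (simp add: order_eq_iff)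

text \<open>Programs have no conditional, so the branch is selected by factors 0 and 1; both
  branches are total, so evaluating both is harmless.\<close>

lemma cfn_if:
  assumes "cpred X P" "cfn X F" "cfn X G"
  shows "cfn X (\<lambda>e. if P e then F e else G e)"
proof -
  have "cfn X (\<lambda>e. (if P e then 1 else 0) * F e + (1 - (if P e then 1 else 0)) * G e)"
    using assms(1) unfolding cpred_def by (intro cfn_mult cfn_add cfn_diff cfn_const assms)
  moreover have "(if P e then 1 else 0) * F e + (1 - (if P e then 1 else 0)) * G e
      = (if P e then F e else G e)" for e by simp
  ultimately show ?thesis by (simp only:)
qed

lemma cpred_oracle: "cfn X F \<Longrightarrow> cpred X (\<lambda>e. F e \<in> X)"
  unfolding cpred_def
proof (rule cfn_substitute1[where f = "\<lambda>x. if x \<in> X then 1 else 0"])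
  show "cfn X (\<lambda>e. if e 0 \<in> X then 1 else 0)" unfolding cfn_def
    by (intro exI[of _ Query] exI[of _ 1]) (use eval.Query[of X] in simp)
qed

lemma cpred_substitute1: "cpred X (\<lambda>e. P (e 0)) \<Longrightarrow> cfn X G \<Longrightarrow> cpred X (\<lambda>e. P (G e))"
  unfolding cpred_def by (rule cfn_substitute1)

lemma cpred_substitute2:
  "cpred X (\<lambda>e. P (e 0) (e 1)) \<Longrightarrow> cfn X G \<Longrightarrow> cfn X H \<Longrightarrow> cpred X (\<lambda>e. P (G e) (H e))"
  unfolding cpred_def by (rule cfn_substitute2)

section \<open>Unbounded and bounded search\<close>

lemma eval_Mu_pred:
  assumes "\<And>n. eval X p (n # xs) (if P n then 0 else 1)"
  shows "(\<exists>y. eval X (Mu p) xs y) \<longleftrightarrow> (\<exists>n. P n)"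
    and "\<exists>n. P n \<Longrightarrow> eval X (Mu p) xs (LEAST n. P n)"
proof -
  show *: "eval X (Mu p) xs (LEAST n. P n)" if "\<exists>n. P n"
  proof (rule eval.Mu)
    show "eval X p ((LEAST n. P n) # xs) 0"
      using assms[of "LEAST n. P n"] LeastI_ex[OF that] by simp
    show "\<exists>y>0. eval X p (i # xs) y" if "i < (LEAST n. P n)" for i
      using assms[of i] not_less_Least[OF that] by auto
  qed
  have "P n" if "eval X (Mu p) xs n" for n
    using that
  proof cases
    case Mu
    then show ?thesis using eval_deterministic[OF assms[of n], of 0] by (auto split: if_splits)
  qed
  with * show "(\<exists>y. eval X (Mu p) xs y) \<longleftrightarrow> (\<exists>n. P n)" by blast
qed

text \<open>\<open>cfn\<close> demands a value in every environment; the existence assumption makes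
  the search always stop.\<close>

lemma cfn_Least:
  assumes "cpred X (\<lambda>e. P (e 0) (\<lambda>i. e (Suc i)))" and "\<And>e. \<exists>n. P n e"
  shows "cfn X (\<lambda>e. LEAST n. P n e)"
proof -
  have "cfn X (\<lambda>e. if P (e 0) (\<lambda>i. e (Suc i)) then 0 else 1)"
    by (intro cfn_if assms cfn_const)
  then obtain k where "\<And>K. k \<le> K \<Longrightarrow>
      \<exists>p. \<forall>e. eval X p (map e [0..<K]) (if P (e 0) (\<lambda>i. e (Suc i)) then 0 else 1)"
    by (auto simp: cfn_eventually eventually_sequentially)
  then obtain p where
    p: "\<And>e. eval X p (map e [0..<Suc k]) (if P (e 0) (\<lambda>i. e (Suc i)) then 0 else 1)"
    by (meson le_SucI order_refl)
  have "eval X p (n # map e [0..<k]) (if P n e then 0 else 1)" for n e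
    using p[of "case_nat n e"] by (simp add: map_upt_Suc del: upt_Suc)
  then have "eval X (Mu p) (map e [0..<k]) (LEAST n. P n e)" for e
    by (rule eval_Mu_pred(2)) (rule assms(2))
  then show ?thesis unfolding cfn_def by blast
qed

text \<open>The bound itself also stops the search, which is therefore total and ends below
  \<open>N e\<close> exactly if a witness lies there.\<close>

lemma cpred_ex_less:
  assumes P: "cpred X (\<lambda>e. P (e 0) (\<lambda>i. e (Suc i)))" and N: "cfn X N"
  shows "cpred X (\<lambda>e. \<exists>b<N e. P b e)"
proof -
  have "cfn X (\<lambda>e. LEAST b. P b e \<or> N e \<le> b)"
  proof (rule cfn_Least)
    show "cpred X (\<lambda>e. P (e 0) (\<lambda>i. e (Suc i)) \<or> N (\<lambda>i. e (Suc i)) \<le> e 0)"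
      by (intro cpred_disj cpred_le P cfn_var cfn_substitute[OF N])
  qed auto
  then have "cpred X (\<lambda>e. (LEAST b. P b e \<or> N e \<le> b) < N e)"
    by (rule cpred_less[OF _ N])
  moreover have "(LEAST b. P b e \<or> N e \<le> b) < N e \<longleftrightarrow> (\<exists>b<N e. P b e)" for e
  proof
    assume "(LEAST b. P b e \<or> N e \<le> b) < N e"
    moreover have "P (LEAST b. P b e \<or> N e \<le> b) e \<or> N e \<le> (LEAST b. P b e \<or> N e \<le> b)"
      by (rule LeastI_ex) auto
    ultimately show "\<exists>b<N e. P b e" by auto
  next
    assume "\<exists>b<N e. P b e"
    then show "(LEAST b. P b e \<or> N e \<le> b) < N e"
      using Least_le[of "\<lambda>b. P b e \<or> N e \<le> b"] by (auto intro: order_le_less_trans)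
  qed
  ultimately show ?thesis by simp
qed

lemmas cfn_intros = cfn_const cfn_var cfn_Suc cfn_add cfn_diff cfn_mult cfn_if
  cpred_conj cpred_disj cpred_not cpred_le cpred_less cpred_eq cpred_oracle cpred_ex_less

lemma cfn_div:
  assumes "cfn X F" "0 < L"
  shows "cfn X (\<lambda>e. F e div L)"
proof (rule cfn_substitute1[OF _ assms(1)])
  \<comment> \<open>The quotient is the least \<open>q\<close> whose next multiple
    \<open>Suc q * L\<close> exceeds \<open>x\<close>.\<close>
  have div: "x < Suc q * L \<longleftrightarrow> x div L \<le> q" for x q
    using div_less_iff_less_mult[OF assms(2), of x "Suc q"] by (simp only: less_Suc_eq_le)
  have "cfn X (\<lambda>e. LEAST q. e 0 < Suc q * L)"
  proof (rule cfn_Least)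
    show "\<exists>q. e 0 < Suc q * L" for e :: "nat \<Rightarrow> nat"
      unfolding div by blast
  qed (intro cfn_intros)
  moreover have "(LEAST q. x < Suc q * L) = x div L" for x
    unfolding div by (rule Least_equality) auto
  ultimately show "cfn X (\<lambda>e. e 0 div L)" by simp
qed

lemma cpred_dvd:
  assumes "cfn X F" "0 < L"
  shows "cpred X (\<lambda>e. L dvd F e)"
proof -
  have "cpred X (\<lambda>e. F e = L * (F e div L))"
    by (intro cfn_intros cfn_div assms)
  moreover have "F e = L * (F e div L) \<longleftrightarrow> L dvd F e" for e
    by (metis dvd_mult_div_cancel dvd_triv_left)
  ultimately show ?thesis by (simp only:)
qed

lemma cpred_finite: "finite S \<Longrightarrow> cfn X F \<Longrightarrow> cpred X (\<lambda>e. F e \<in> S)"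
proof (induction rule: finite_induct)
  case empty
  have "cpred X (\<lambda>e. (1::nat) = 0)" by (intro cfn_intros)
  then show ?case by simp
next
  case (insert x S)
  then have "cpred X (\<lambda>e. F e = x \<or> F e \<in> S)" by (intro cfn_intros) auto
  then show ?case by simp
qed

section \<open>Environments versus unary programs\<close>

lemma cfn_unary_iff: "cfn X (\<lambda>e. f (e 0)) \<longleftrightarrow> (\<exists>q. \<forall>x. eval X q [x] (f x))"
proof
  assume "cfn X (\<lambda>e. f (e 0))"
  then obtain p k where p: "\<And>e. eval X p (map e [0..<k]) (f (e 0))" unfolding cfn_def by auto
  \<comment> \<open>\<open>p\<close> expects \<open>k\<close> arguments; those beyond the first are
    filled with zeros, as the value does not depend on them.\<close>
  have "eval X (Comp p (map (\<lambda>i. if i = 0 then Proj 0 else Zero) [0..<k])) [x] (f x)" for x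
  proof (rule eval_Comp_map)
    show "eval X (if i = 0 then Proj 0 else Zero) [x] (if i = 0 then x else 0)" for i :: nat
      using eval.Proj[of 0 "[x]" X] by (auto intro: eval.Zero)
    show "eval X p (map (\<lambda>i. if i = 0 then x else 0) [0..<k]) (f x)"
      using p[of "\<lambda>i. if i = 0 then x else 0"] by simp
  qed
  then show "\<exists>q. \<forall>x. eval X q [x] (f x)" by blast
next
  assume "\<exists>q. \<forall>x. eval X q [x] (f x)"
  then obtain q where "\<And>x. eval X q [x] (f x)" by blast
  then have "eval X q (map e [0..<1]) (f (e 0))" for e by simp
  then show "cfn X (\<lambda>e. f (e 0))" unfolding cfn_def by blast
qed

text \<open>\<open>computable_in\<close> says nothing about input 0, where the program may diverge.
  Precomposing with the successor avoids 0, and \<open>f 0\<close> is patched in as a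
  constant.\<close>

lemma computable_in_iff: "computable_in X f \<longleftrightarrow> cfn X (\<lambda>e. f (e 0))"
proof
  assume "computable_in X f"
  then obtain p where p: "\<And>x. x \<ge> 1 \<Longrightarrow> eval X p [x] (f x)" unfolding computable_in_def by auto
  have "eval X (Comp p [Comp Succ [Proj 0]]) (map e [0..<1]) (f (Suc (e 0)))" for e
    by (intro eval_Comp1[where y = "Suc (e 0)"] eval_Comp1[where y = "e 0"] p eval.Succ)
      (use eval.Proj[of 0 "[e 0]"] in auto)
  then have "cfn X (\<lambda>e. f (Suc (e 0)))" unfolding cfn_def by blast
  then have "cfn X (\<lambda>e. if e 0 = 0 then f 0 else f (Suc (e 0 - 1)))"
    by (intro cfn_intros cfn_substitute1[where f = "\<lambda>x. f (Suc x)" and G = "\<lambda>e. e 0 - 1"])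
  moreover have "(if x = 0 then f 0 else f (Suc (x - 1))) = f x" for x by simp
  ultimately show "cfn X (\<lambda>e. f (e 0))" by simp
next
  assume "cfn X (\<lambda>e. f (e 0))"
  then show "computable_in X f" unfolding cfn_unary_iff computable_in_def by blast
qed

lemma turing_le_iff: "A \<le>\<^sub>T B \<longleftrightarrow> cpred B (\<lambda>e. e 0 \<in> A)"
  by (simp add: turing_le_def computable_in_iff cpred_def char_fun_def)

lemma decidable_iff: "decidable A \<longleftrightarrow> cpred {} (\<lambda>e. e 0 \<in> A)"
  by (simp add: decidable_def computable_in_iff cpred_def char_fun_def)

section \<open>Turing reducibility\<close>

primrec replace_query :: "prog \<Rightarrow> prog \<Rightarrow> prog" where
  "replace_query q Zero = Zero"
| "replace_query q Succ = Succ"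
| "replace_query q (Proj i) = Proj i"
| "replace_query q Query = q"
| "replace_query q (Comp f gs) = Comp (replace_query q f) (map (replace_query q) gs)"
| "replace_query q (PrimRec f g) = PrimRec (replace_query q f) (replace_query q g)"
| "replace_query q (Mu f) = Mu (replace_query q f)"

text \<open>A query is answered only on one-element lists, so a subroutine deciding \<open>X\<close>
  from oracle \<open>Y\<close> can take its place.\<close>

lemma eval_replace_query:
  assumes "\<And>x. eval Y q [x] (if x \<in> X then 1 else 0)" and "eval X p xs y"
  shows "eval Y (replace_query q p) xs y"
  using assms(2)
proof induction
  case (Comp xs gs ys f z)
  have "list_all2 (\<lambda>g y. eval Y g xs y) (map (replace_query q) gs) ys"
    using Comp.IH(1) by (auto simp: list_all2_conv_all_nth)
  then show ?case using Comp.IH(2) by (auto intro: eval.Comp)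
next
  case (Query x)
  then show ?case using assms(1)[of x] by simp
next
  case (Mu f n xs)
  then show ?case by (auto intro!: eval.Mu)
qed (auto intro: eval.intros)

lemma cfn_change_oracle:
  assumes F: "cfn X F" and "X \<le>\<^sub>T Y"
  shows "cfn Y F"
proof -
  obtain q where q: "\<And>x. eval Y q [x] (if x \<in> X then 1 else 0)"
    using assms(2) unfolding turing_le_iff cpred_def
    using cfn_unary_iff[of Y "\<lambda>x. if x \<in> X then 1 else 0"] by blast
  show ?thesis using F eval_replace_query[OF q] unfolding cfn_def by blast
qed


lemma empty_turing_le: "{} \<le>\<^sub>T Y"
  unfolding turing_le_iff by (intro cpred_finite cfn_var) simp

lemma turing_le_trans: "X \<le>\<^sub>T Y \<Longrightarrow> Y \<le>\<^sub>T Z \<Longrightarrow> X \<le>\<^sub>T Z"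
  using cfn_change_oracle[of Y "\<lambda>e. if e 0 \<in> X then 1 else 0" Z]
  by (simp add: turing_le_iff[of X] cpred_def)

lemma almost_equal_sym: "A \<approx> B \<Longrightarrow> B \<approx> A"
  by (simp add: almost_equal_def Un_commute)

lemma almost_equal_turing_le:
  assumes "A \<approx> B"
  shows "A \<le>\<^sub>T B"
proof -
  define D where "D = (A - B) \<union> (B - A)"
  have "finite D" using assms by (simp add: D_def almost_equal_def)
  \<comment> \<open>On the finite set \<open>D\<close> the answer of the oracle is reversed.\<close>
  then have "cpred B (\<lambda>e. e 0 \<in> B \<and> e 0 \<notin> D \<or> e 0 \<notin> B \<and> e 0 \<in> D)"
    by (intro cfn_intros cpred_finite)
  moreover have "x \<in> B \<and> x \<notin> D \<or> x \<notin> B \<and> x \<in> D \<longleftrightarrow> x \<in> A" for x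
    by (auto simp: D_def)
  ultimately show ?thesis by (simp only: turing_le_iff)
qed

section \<open>Enumeration of recursively enumerable sets\<close>

text \<open>The value \<open>Suc y\<close> stands for the output \<open>y\<close>, and \<open>0\<close> for failure. Only unbounded search
  can diverge, so it is enough to let the fuel \<open>s\<close> bound the searches.\<close>

fun fuel_eval :: "nat set \<Rightarrow> nat \<Rightarrow> prog \<Rightarrow> nat list \<Rightarrow> nat" where
  "fuel_eval X s Zero xs = 1"
| "fuel_eval X s Succ xs = (if length xs = 1 then Suc (Suc (xs ! 0)) else 0)"
| "fuel_eval X s (Proj i) xs = (if i < length xs then Suc (xs ! i) else 0)"
| "fuel_eval X s Query xs = (if length xs = 1 then Suc (if xs ! 0 \<in> X then 1 else 0) else 0)"
| "fuel_eval X s (Comp f gs) xs =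
    (if \<exists>g\<in>set gs. fuel_eval X s g xs = 0 then 0
     else fuel_eval X s f (map (\<lambda>g. fuel_eval X s g xs - 1) gs))"
| "fuel_eval X s (PrimRec f g) xs =
    (if xs = [] then 0
     else rec_nat (fuel_eval X s f (tl xs))
       (\<lambda>n r. if r = 0 then 0 else fuel_eval X s g (n # (r - 1) # tl xs)) (xs ! 0))"
| "fuel_eval X s (Mu f) xs =
    (let n = (LEAST n. fuel_eval X s f (n # xs) \<le> 1 \<or> s \<le> n)
     in if n < s \<and> fuel_eval X s f (n # xs) = 1 then Suc n else 0)"

lemma fuel_eval_sound: "fuel_eval X s p xs = Suc y \<Longrightarrow> eval X p xs y"
proof (induction p arbitrary: xs y)
  case Succ
  then show ?case by (cases xs) (auto split: if_splits intro: eval.intros)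
next
  case (Proj i)
  then show ?case by (auto split: if_splits intro: eval.intros)
next
  case Query
  then obtain x where "xs = [x]" by (auto simp: length_Suc_conv split: if_splits)
  with Query show ?case using eval.Query[of X x] by (auto split: if_splits)
next
  case (Comp f gs)
  have nz: "\<forall>g\<in>set gs. fuel_eval X s g xs \<noteq> 0"
    and f: "fuel_eval X s f (map (\<lambda>g. fuel_eval X s g xs - 1) gs) = Suc y"
    using Comp.prems by (auto split: if_splits)
  have "eval X g xs (fuel_eval X s g xs - 1)" if "g \<in> set gs" for g
    using Comp.IH(2)[OF that, of xs "fuel_eval X s g xs - 1"] nz that by simp
  then have "list_all2 (\<lambda>g y. eval X g xs y) gs (map (\<lambda>g. fuel_eval X s g xs - 1) gs)"
    by (auto simp: list_all2_conv_all_nth)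
  then show ?case using Comp.IH(1)[OF f] by (rule eval.Comp)
next
  case (PrimRec f g)
  obtain m ys where xs: "xs = m # ys" using PrimRec.prems by (cases xs) auto
  let ?r = "rec_nat (fuel_eval X s f ys) (\<lambda>n r. if r = 0 then 0 else fuel_eval X s g (n # (r - 1) # ys))"
  have "?r m = Suc y \<Longrightarrow> eval X (PrimRec f g) (m # ys) y" for m y
  proof (induction m arbitrary: y)
    case 0
    then show ?case by (simp add: eval.PrimRec_0 PrimRec.IH)
  next
    case (Suc m)
    then obtain r where "?r m = Suc r" by (cases "?r m") auto
    with Suc show ?case by (auto intro!: eval.PrimRec_Suc[where r = r] PrimRec.IH)
  qed
  from this[of m y] show ?case using PrimRec.prems by (simp add: xs cong: if_cong)
next
  case (Mu f)
  \<comment> \<open>Values 0 and 1 encode failure and output 0, and either one stops the search; at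
    every earlier argument the output is thus positive.\<close>
  define n where "n = (LEAST n. fuel_eval X s f (n # xs) \<le> 1 \<or> s \<le> n)"
  have n: "n < s" "fuel_eval X s f (n # xs) = 1" "y = n"
    using Mu.prems unfolding fuel_eval.simps Let_def n_def[symmetric] by (auto split: if_splits)
  have "\<exists>y>0. eval X f (i # xs) y" if "i < n" for i
  proof -
    have "1 < fuel_eval X s f (i # xs)"
      using not_less_Least[OF that[unfolded n_def]] by simp
    then show ?thesis using Mu.IH[of "i # xs" "fuel_eval X s f (i # xs) - 1"]
      by (intro exI[of _ "fuel_eval X s f (i # xs) - 1"]) auto
  qed
  then show ?case using Mu.IH[of "n # xs" 0] n by (auto intro: eval.Mu)
qed (auto intro: eval.Zero)

text \<open>Success for all large fuel, rather than for some fuel, lets finitely many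
  subcomputations succeed with a common one.\<close>

lemma fuel_eval_complete:
  "eval X p xs y \<Longrightarrow> \<forall>\<^sub>F s in sequentially. fuel_eval X s p xs = Suc y"
proof (induction rule: eval.induct)
  case (Comp xs gs ys f z)
  have "\<forall>\<^sub>F s in sequentially. \<forall>i\<in>{..<length gs}. fuel_eval X s (gs ! i) xs = Suc (ys ! i)"
    using Comp.IH(1) by (simp add: eventually_ball_finite_distrib list_all2_conv_all_nth)
  with Comp.IH(2) show ?case
  proof eventually_elim
    case (elim s)
    then have "map (\<lambda>g. fuel_eval X s g xs - 1) gs = ys"
      using list_all2_lengthD[OF Comp.IH(1)] by (intro nth_equalityI) auto
    moreover have "\<forall>g\<in>set gs. fuel_eval X s g xs \<noteq> 0"
      using elim by (auto simp: in_set_conv_nth)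
    ultimately show ?case using elim by simp
  qed
next
  case (PrimRec_Suc f g n xs r y)
  from PrimRec_Suc.IH show ?case by eventually_elim (simp cong: if_cong)
next
  case (Mu f n xs)
  have "\<forall>i\<in>{..<n}. \<forall>\<^sub>F s in sequentially. 1 < fuel_eval X s f (i # xs)"
  proof
    fix i assume "i \<in> {..<n}"
    then obtain y where "y > 0" "\<forall>\<^sub>F s in sequentially. fuel_eval X s f (i # xs) = Suc y"
      using Mu.IH(2) by auto
    then show "\<forall>\<^sub>F s in sequentially. 1 < fuel_eval X s f (i # xs)"
      by (auto elim: eventually_mono)
  qed
  then have "\<forall>\<^sub>F s in sequentially. \<forall>i\<in>{..<n}. 1 < fuel_eval X s f (i # xs)"
    by (simp add: eventually_ball_finite_distrib)
  with Mu.IH(1) eventually_gt_at_top[of n] show ?case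
  proof eventually_elim
    case (elim s)
    have "(LEAST n. fuel_eval X s f (n # xs) \<le> 1 \<or> s \<le> n) = n"
      by (rule Least_equality) (use elim in \<open>auto simp: not_le[symmetric]\<close>)
    with elim show ?case by simp
  qed
qed auto

lemma eval_iff_fuel_eval: "(\<exists>y. eval X p xs y) \<longleftrightarrow> (\<exists>s. fuel_eval X s p xs \<noteq> 0)"
proof
  assume "\<exists>y. eval X p xs y"
  then obtain y where "\<forall>\<^sub>F s in sequentially. fuel_eval X s p xs = Suc y"
    using fuel_eval_complete by blast
  then obtain s where "fuel_eval X s p xs = Suc y" by (auto dest: eventually_happens)
  then show "\<exists>s. fuel_eval X s p xs \<noteq> 0" by (metis Zero_not_Suc)
next
  assume "\<exists>s. fuel_eval X s p xs \<noteq> 0"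
  then obtain s y where "fuel_eval X s p xs = Suc y" using not0_implies_Suc by blast
  then show "\<exists>y. eval X p xs y" using fuel_eval_sound by blast
qed

text \<open>Induction on the fixed \<open>p\<close> builds a program simulating it with variable
  fuel. The arguments are a list \<open>hs\<close> of functions of the environment, so their number
  is constant.\<close>

lemma cfn_fuel_eval:
  "cfn X S \<Longrightarrow> (\<And>h. h \<in> set hs \<Longrightarrow> cfn X h) \<Longrightarrow>
    cfn X (\<lambda>e. fuel_eval X (S e) p (map (\<lambda>h. h e) hs))"
proof (induction p arbitrary: S hs)
  case Zero
  show ?case by (simp add: cfn_const)
next
  case Succ
  show ?case
  proof (cases "length hs = 1")
    case True
    then have "cfn X (hs ! 0)" using Succ.prems by simp
    then have "cfn X (\<lambda>e. (hs ! 0) e)" by simp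
    then have "cfn X (\<lambda>e. Suc (Suc ((hs ! 0) e)))" by (intro cfn_Suc)
    with True show ?thesis by simp
  qed (simp add: cfn_const)
next
  case (Proj i)
  show ?case
  proof (cases "i < length hs")
    case True
    then have "cfn X (\<lambda>e. Suc ((hs ! i) e))" using Proj.prems by (intro cfn_Suc) simp
    with True show ?thesis by simp
  qed (simp add: cfn_const)
next
  case Query
  show ?case
  proof (cases "length hs = 1")
    case True
    then have "cfn X (\<lambda>e. Suc (if (hs ! 0) e \<in> X then 1 else 0))"
      using Query.prems by (intro cfn_Suc cfn_if cfn_const cpred_oracle) simp
    with True show ?thesis by simp
  qed (simp add: cfn_const)
next
  case (Comp f gs)
  let ?ev = "\<lambda>g e. fuel_eval X (S e) g (map (\<lambda>h. h e) hs)"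
  have ev: "cfn X (?ev g)" if "g \<in> set gs" for g
    using Comp.IH(2)[OF that Comp.prems] .
  have "cpred X (\<lambda>e. \<exists>g\<in>set gs'. ?ev g e = 0)" if "set gs' \<subseteq> set gs" for gs'
    using that
  proof (induction gs')
    case Nil
    have "cpred X (\<lambda>e. (1::nat) = 0)" by (intro cfn_intros)
    then show ?case by simp
  next
    case (Cons g gs')
    then have "cpred X (\<lambda>e. ?ev g e = 0 \<or> (\<exists>g\<in>set gs'. ?ev g e = 0))"
      by (intro cpred_disj cpred_eq cfn_const ev) auto
    then show ?case by simp
  qed
  moreover have "cfn X (\<lambda>e. fuel_eval X (S e) f (map (\<lambda>h. h e) (map (\<lambda>g e. ?ev g e - 1) gs)))"
    by (rule Comp.IH(1)[OF Comp.prems(1)]) (auto intro!: cfn_diff ev cfn_const simp del: One_nat_def)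
  ultimately have "cfn X (\<lambda>e. if \<exists>g\<in>set gs. ?ev g e = 0 then 0
      else fuel_eval X (S e) f (map (\<lambda>h. h e) (map (\<lambda>g e. ?ev g e - 1) gs)))"
    by (intro cfn_if cfn_const) auto
  then show ?case by (simp add: o_def cong: if_cong)
next
  case (PrimRec f g)
  show ?case
  proof (cases hs)
    case (Cons n ks)
    \<comment> \<open>Under the two variables bound by the recursion, outer functions must read two
      places further on.\<close>
    define shift :: "((nat \<Rightarrow> nat) \<Rightarrow> nat) \<Rightarrow> (nat \<Rightarrow> nat) \<Rightarrow> nat" where
      "shift = (\<lambda>h e. h (\<lambda>i. e (Suc (Suc i))))"
    have shift: "cfn X (shift h)" if "cfn X h" for h
      unfolding shift_def by (rule cfn_substitute[OF that cfn_var])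
    have "cfn X (\<lambda>e. fuel_eval X (shift S e) g
        (map (\<lambda>h. h e) ((\<lambda>e. e 0) # (\<lambda>e. e (Suc 0) - 1) # map shift ks)))"
      using PrimRec.prems by (intro PrimRec.IH(2) shift)
        (auto simp: Cons simp del: One_nat_def intro: shift cfn_var cfn_diff cfn_const)
    then have "cfn X (\<lambda>e. fuel_eval X (S (\<lambda>i. e (Suc (Suc i)))) g
        (e 0 # (e (Suc 0) - 1) # map (\<lambda>h. h (\<lambda>i. e (Suc (Suc i)))) ks))"
      by (simp add: o_def shift_def)
    then have "cfn X (\<lambda>e. rec_nat (fuel_eval X (S e) f (map (\<lambda>h. h e) ks))
        (\<lambda>i r. if r = 0 then 0 else fuel_eval X (S e) g (i # (r - 1) # map (\<lambda>h. h e) ks)) (n e))"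
      using PrimRec.prems Cons
      by (intro cfn_rec_nat PrimRec.IH(1) cfn_if cpred_eq cfn_var cfn_const) auto
    then show ?thesis by (simp add: Cons cong: if_cong)
  qed (simp add: cfn_const)
next
  case (Mu f)
  have *: "cfn X (\<lambda>e. fuel_eval X (S e) f (N e # map (\<lambda>h. h e) ks))"
    if "cfn X S" "cfn X N" "\<And>h. h \<in> set ks \<Longrightarrow> cfn X h" for S N ks
    using Mu.IH[of S "N # ks"] that by auto
  define shift :: "((nat \<Rightarrow> nat) \<Rightarrow> nat) \<Rightarrow> (nat \<Rightarrow> nat) \<Rightarrow> nat" where
    "shift = (\<lambda>h e. h (\<lambda>i. e (Suc i)))"
  have shift: "cfn X (shift h)" if "cfn X h" for h
    unfolding shift_def by (rule cfn_substitute[OF that cfn_var])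
  have "cfn X (\<lambda>e. fuel_eval X (shift S e) f (e 0 # map (\<lambda>h. h e) (map shift hs)))"
    by (rule *) (auto intro: shift cfn_var Mu.prems)
  then have "cpred X (\<lambda>e. fuel_eval X (shift S e) f (e 0 # map (\<lambda>h. h e) (map shift hs)) \<le> 1
      \<or> shift S e \<le> e 0)"
    by (intro cpred_disj cpred_le cfn_var cfn_const shift[OF Mu.prems(1)])
  then have n: "cfn X (\<lambda>e. LEAST n. fuel_eval X (S e) f (n # map (\<lambda>h. h e) hs) \<le> 1 \<or> S e \<le> n)"
    by (intro cfn_Least) (auto simp: o_def shift_def)
  show ?case
    unfolding fuel_eval.simps Let_def
    by (intro cfn_if cpred_conj cpred_less cpred_eq cfn_Suc cfn_const n * Mu.prems(1))
      (use Mu.prems in auto)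
qed

text \<open>Success with fuel \<open>s\<close> is decidable, so an r.e. set is the projection of a
  decidable relation; conversely, searching for \<open>s\<close> halts exactly on the
  projection.\<close>

lemma re_iff:
  "re A \<longleftrightarrow> (\<exists>Q. cpred {} (\<lambda>e. Q (e 0) (e 1)) \<and> A = {x \<in> pnat. \<exists>s. Q s x})"
proof
  assume "re A"
  then obtain p where A: "A = {x \<in> pnat. \<exists>y. eval {} p [x] y}" unfolding re_def by auto
  have "cpred {} (\<lambda>e. fuel_eval {} (e 0) p [e 1] \<noteq> 0)"
    using cfn_fuel_eval[of "{}" "\<lambda>e. e 0" "[\<lambda>e. e 1]" p]
    by (intro cpred_not cpred_eq cfn_const) (simp add: cfn_var)
  then show "\<exists>Q. cpred {} (\<lambda>e. Q (e 0) (e 1)) \<and> A = {x \<in> pnat. \<exists>s. Q s x}"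
    unfolding A eval_iff_fuel_eval by (intro exI[of _ "\<lambda>s x. fuel_eval {} s p [x] \<noteq> 0"]) simp
next
  assume "\<exists>Q. cpred {} (\<lambda>e. Q (e 0) (e 1)) \<and> A = {x \<in> pnat. \<exists>s. Q s x}"
  then obtain Q where Q: "cpred {} (\<lambda>e. Q (e 0) (e 1))" and A: "A = {x \<in> pnat. \<exists>s. Q s x}"
    by auto
  have "cfn {} (\<lambda>e. if Q (e 0) (e 1) then 0 else 1)"
    by (intro cfn_intros Q)
  then obtain k where "\<And>K. k \<le> K \<Longrightarrow>
      \<exists>p. \<forall>e. eval {} p (map e [0..<K]) (if Q (e 0) (e 1) then 0 else 1)"
    by (auto simp: cfn_eventually eventually_sequentially)
  then obtain p where
    p: "\<And>e. eval {} p (map e [0..<k]) (if Q (e 0) (e 1) then 0 else 1)"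
    by (meson order_refl)
  let ?p = "Comp p (map (\<lambda>i. if i < 2 then Proj i else Zero) [0..<k])"
  have "eval {} ?p [s, x] (if Q s x then 0 else 1)" for s x
  proof (rule eval_Comp_map)
    show "eval {} (if i < 2 then Proj i else Zero) [s, x] (if i < 2 then [s, x] ! i else 0)" for i
      using eval.Proj[of i "[s, x]"] by (auto intro: eval.Zero)
    show "eval {} p (map (\<lambda>i. if i < 2 then [s, x] ! i else 0) [0..<k]) (if Q s x then 0 else 1)"
      using p[of "\<lambda>i. if i < 2 then [s, x] ! i else 0"] by simp
  qed
  then have "(\<exists>y. eval {} (Mu ?p) [x] y) \<longleftrightarrow> (\<exists>s. Q s x)" for x
    by (rule eval_Mu_pred(1))
  then show "re A" unfolding re_def A by blast
qed


section \<open>Listings of infinite r.e. sets\<close>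

lemma cfn_enumerate:
  assumes "infinite S" and S: "cpred X (\<lambda>e. e 0 \<in> S)"
  shows "cfn X (\<lambda>e. enumerate S (e 0))"
proof -
  have mem: "cpred X (\<lambda>e. e i \<in> S)" for i
    using S cfn_var by (rule cpred_substitute1)
  have "rec_nat (LEAST s. s \<in> S) (\<lambda>i r. LEAST s. s \<in> S \<and> r < s) n = enumerate S n" for n
    by (induction n) (simp_all add: enumerate_0 enumerate_Suc'' assms(1))
  moreover have "cfn X (\<lambda>e. rec_nat (LEAST s. s \<in> S) (\<lambda>i r. LEAST s. s \<in> S \<and> r < s) (e 0))"
  proof (intro cfn_rec_nat cfn_const cfn_var cfn_Least)
    show "\<exists>s. s \<in> S \<and> e (Suc 0) < s" for e :: "nat \<Rightarrow> nat"
      using assms(1) by (auto simp: infinite_nat_iff_unbounded)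
  qed (intro cpred_conj cpred_less mem cfn_var)
  ultimately show ?thesis by simp
qed

text \<open>The excess of \<open>t\<close> over the largest square below it takes every value infinitely often, so it
  lets one number \<open>t\<close> serve as both a candidate element and a search bound.\<close>

definition square_excess :: "nat \<Rightarrow> nat" where
  "square_excess t = t - (LEAST r. t < Suc r * Suc r) * (LEAST r. t < Suc r * Suc r)"

lemma square_excess:
  assumes "a \<le> r"
  shows "square_excess (r * r + a) = a"
proof -
  have "(LEAST q. r * r + a < Suc q * Suc q) = r"
  proof (rule Least_equality)
    show "r * r + a < Suc r * Suc r" using assms by simp
    show "r \<le> q" if "r * r + a < Suc q * Suc q" for q
    proof (rule ccontr)
      assume "\<not> r \<le> q"
      then have "Suc q * Suc q \<le> r * r" by (intro mult_le_mono) auto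
      with that show False by simp
    qed
  qed
  then show ?thesis by (simp add: square_excess_def)
qed

lemma cfn_square_excess: "cfn X F \<Longrightarrow> cfn X (\<lambda>e. square_excess (F e))"
proof (rule cfn_substitute1[where f = square_excess])
  have "cfn X (\<lambda>e. LEAST r. e 0 < Suc r * Suc r)"
  proof (rule cfn_Least)
    show "\<exists>r. e 0 < Suc r * Suc r" for e :: "nat \<Rightarrow> nat"
      by (rule exI[of _ "e 0"]) simp
  qed (intro cfn_intros)
  then show "cfn X (\<lambda>e. square_excess (e 0))"
    unfolding square_excess_def by (intro cfn_diff cfn_mult cfn_var)
qed

text \<open>Each element of \<open>A\<close> is represented by the first \<open>t\<close> that
  confirms it. These \<open>t\<close> form an infinite decidable set, whose increasing enumeration
  lists \<open>A\<close> without repetition.\<close>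

lemma re_infinite_listing:
  assumes "re A" "infinite A"
  obtains h where "listing h A"
proof -
  obtain Q where Q: "cpred {} (\<lambda>e. Q (e 0) (e 1))" and A: "A = {x \<in> pnat. \<exists>s. Q s x}"
    using assms(1) re_iff by blast
  \<comment> \<open>The candidate coded by \<open>t\<close> is positive and is confirmed by some
    \<open>s\<close> below \<open>t\<close>.\<close>
  define D where "D t \<longleftrightarrow> 0 < square_excess t \<and> (\<exists>s<t. Q s (square_excess t))" for t
  define S where "S = {t. D t \<and> \<not> (\<exists>u<t. square_excess u = square_excess t \<and> D u)}"
  have Q': "cpred {} (\<lambda>e. Q (F e) (G e))" if "cfn {} F" "cfn {} G" for F G
    by (rule cpred_substitute2[OF Q that])
  have D: "cpred {} (\<lambda>e. D (F e))" if "cfn {} F" for F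
  proof (rule cpred_substitute1[OF _ that])
    show "cpred {} (\<lambda>e. D (e 0))"
      unfolding D_def by (intro cpred_conj cpred_less cpred_ex_less Q'
          cfn_square_excess cfn_var cfn_const)
  qed
  have S: "cpred {} (\<lambda>e. e 0 \<in> S)"
    unfolding S_def mem_Collect_eq
    by (intro cpred_conj cpred_not cpred_ex_less cpred_eq D cfn_square_excess cfn_var)
  have "square_excess t \<in> A" if "t \<in> S" for t
    using that by (auto simp: S_def D_def A)
  moreover have "a \<in> square_excess ` S" if a: "a \<in> A" for a
  proof -
    obtain s where s: "Q s a" "1 \<le> a" using a by (auto simp: A)
    \<comment> \<open>Large enough that \<open>a \<le> ?r\<close>, which makes the excess equal to
      \<open>a\<close>, and that \<open>s\<close> lies below \<open>?r * ?r + a\<close>.\<close>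
    let ?r = "Suc (a + s)"
    have "s < ?r * ?r + a" by simp
    moreover have "square_excess (?r * ?r + a) = a" by (rule square_excess) simp
    ultimately have "\<exists>t. square_excess t = a \<and> D t"
      unfolding D_def using s by (metis One_nat_def Suc_le_eq)
    then have "\<exists>t. (square_excess t = a \<and> D t) \<and> (\<forall>u<t. \<not> (square_excess u = a \<and> D u))"
      by (rule exists_least_iff[THEN iffD1])
    then show ?thesis by (auto simp: S_def)
  qed
  ultimately have img: "square_excess ` S = A" by blast
  have "inj_on square_excess S"
  proof (rule inj_onI)
    fix t u assume "t \<in> S" "u \<in> S" "square_excess t = square_excess u"
    then show "t = u" by (cases t u rule: linorder_cases) (auto simp: S_def)
  qed
  then have bij: "bij_betw square_excess S A" using img by (simp add: bij_betw_def)
  have "infinite S" using assms(2) img by auto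
  then have "bij_betw (enumerate S) UNIV S" by (rule bij_enumerate)
  \<comment> \<open>Listings are indexed from 1, \<open>enumerate\<close> from 0.\<close>
  moreover have "bij_betw (\<lambda>k. k - 1) pnat UNIV"
    by (rule bij_betw_byWitness[where f' = Suc]) auto
  ultimately have "bij_betw (square_excess \<circ> (enumerate S \<circ> (\<lambda>k. k - 1))) pnat A"
    using bij by (meson bij_betw_trans)
  moreover have "cfn {} (\<lambda>e. square_excess (enumerate S (e 0 - 1)))"
    by (rule cfn_square_excess[OF cfn_substitute1[OF cfn_enumerate[OF \<open>infinite S\<close> S]]])
      (intro cfn_diff cfn_var cfn_const)
  ultimately have "listing (\<lambda>k. square_excess (enumerate S (k - 1))) A"
    using assms by (simp add: listing_def computable_in_iff o_def)
  then show ?thesis by (rule that)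
qed

section \<open>Uniform sets are Turing equivalent\<close>

lemma listing_Suc:
  assumes "listing h A"
  shows "cfn X F \<Longrightarrow> cfn X (\<lambda>e. h (Suc (F e)))" "inj (\<lambda>i. h (Suc i))" "range (\<lambda>i. h (Suc i)) = A"
proof -
  have "cfn {} (\<lambda>e. h (e 0))" and bij: "bij_betw h pnat A"
    using assms by (auto simp: listing_def computable_in_iff)
  from this(1) have "cfn X (\<lambda>e. h (e 0))" by (rule cfn_change_oracle[OF _ empty_turing_le])
  then show "cfn X (\<lambda>e. h (Suc (F e)))" if "cfn X F"
    by (rule cfn_substitute1) (intro cfn_Suc that)
  have "bij_betw Suc UNIV pnat"
    by (rule bij_betw_byWitness[where f' = "\<lambda>k. k - 1"]) auto
  then have "bij_betw (h \<circ> Suc) UNIV A" using bij by (rule bij_betw_trans)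
  then show "inj (\<lambda>i. h (Suc i))" "range (\<lambda>i. h (Suc i)) = A"
    by (simp_all add: bij_betw_def o_def)
qed

lemma uniformE:
  assumes "A \<sim> B"
  obtains h g where "\<And>X F. cfn X F \<Longrightarrow> cfn X (\<lambda>e. h (F e))" "\<And>X F. cfn X F \<Longrightarrow> cfn X (\<lambda>e. g (F e))"
    "inj h" "inj g" "range h = A" "range g = B" "\<And>i j. h i < h j \<longleftrightarrow> g i < g j"
proof -
  obtain h g where hg: "listing h A" "listing g B" "uniform_listings h g"
    using assms uniform_def by blast
  show ?thesis
    by (rule that[of "\<lambda>i. h (Suc i)" "\<lambda>i. g (Suc i)"])
      (use hg listing_Suc in \<open>auto simp: uniform_listings_def\<close>)
qed

lemma uniform_sym: "A \<sim> B \<Longrightarrow> B \<sim> A"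
  by (auto simp: uniform_def uniform_listings_def)

text \<open>To decide \<open>x \<in> A\<close>, take some \<open>h i > x\<close>: the elements of \<open>A\<close> below \<open>h i\<close> correspond to the
  elements of \<open>B\<close> below \<open>g i\<close>, which the oracle supplies.\<close>

lemma uniform_turing_le:
  assumes "A \<sim> B"
  shows "A \<le>\<^sub>T B"
proof -
  obtain h g where h: "\<And>X F. cfn X F \<Longrightarrow> cfn X (\<lambda>e. h (F e))"
    and g: "\<And>X F. cfn X F \<Longrightarrow> cfn X (\<lambda>e. g (F e))"
    and inj: "inj h" "inj g" and ran: "range h = A" "range g = B"
    and mono: "\<And>i j. h i < h j \<longleftrightarrow> g i < g j"
    using uniformE[OF assms] by blast
  have "infinite A" using inj(1) ran(1) range_inj_infinite by blast
  \<comment> \<open>The second disjunct is false here; in the program below it makes the search for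
    an index stop on numbers outside \<open>B\<close> as well.\<close>
  have inv: "(LEAST i. g i = g j \<or> g j \<notin> B) = j" for j
    using inj(2) ran(2) by (auto dest: injD intro!: Least_equality)
  define m where "m x = (LEAST i. x < h i)" for x
  have m: "x < h (m x)" for x
  proof -
    have "\<exists>i. x < h i"
      using \<open>infinite A\<close> ran(1) by (auto simp: infinite_nat_iff_unbounded)
    then show ?thesis unfolding m_def by (rule LeastI_ex)
  qed
  have "cfn B (\<lambda>e. m (e 0))"
    unfolding m_def
  proof (rule cfn_Least)
    show "\<exists>i. e 0 < h i" for e :: "nat \<Rightarrow> nat"
      using m by blast
  qed (intro cpred_less h cfn_var)
  \<comment> \<open>For each \<open>b\<close> in \<open>B\<close> below \<open>g (m x)\<close>, find
    its index under \<open>g\<close> and compare the value of \<open>h\<close> there with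
    \<open>x\<close>.\<close>
  then have "cpred B (\<lambda>e. \<exists>b<g (m (e 0)). b \<in> B \<and> h (LEAST i. g i = b \<or> b \<notin> B) = e 0)"
  proof (intro cpred_ex_less cpred_conj cpred_oracle cpred_eq g h cfn_var cfn_Least
      cpred_disj cpred_not)
    show "\<exists>i. g i = e 0 \<or> e 0 \<notin> B" for e :: "nat \<Rightarrow> nat"
      unfolding ran(2)[symmetric] by (metis rangeE)
  qed
  moreover have "(\<exists>b<g (m x). b \<in> B \<and> h (LEAST i. g i = b \<or> b \<notin> B) = x) \<longleftrightarrow> x \<in> A" for x
  proof
    assume "\<exists>b<g (m x). b \<in> B \<and> h (LEAST i. g i = b \<or> b \<notin> B) = x"
    then show "x \<in> A" using ran(1) by blast
  next
    assume "x \<in> A"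
    then obtain j where "x = h j" using ran(1) by blast
    then show "\<exists>b<g (m x). b \<in> B \<and> h (LEAST i. g i = b \<or> b \<notin> B) = x"
      using m[of x] mono ran(2) inv[of j] by (intro exI[of _ "g j"]) auto
  qed
  ultimately show ?thesis by (simp only: turing_le_iff)
qed

text \<open>Almost equality and uniformity are symmetric and imply reducibility, so
  \<open>A\<close>, \<open>A'\<close>, \<open>B'\<close>, \<open>B\<close> form a chain of
  reductions in both directions.\<close>

lemma type2_uniform_turing_le:
  assumes "A \<sim>\<^sub>2 B"
  shows "A \<le>\<^sub>T B" "B \<le>\<^sub>T A"
proof -
  obtain A' B' where AB: "A \<approx> A'" "B \<approx> B'" "A' \<sim> B'"
    using assms type2_uniform_def by blast
  then show "A \<le>\<^sub>T B" "B \<le>\<^sub>T A"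
    by (meson turing_le_trans almost_equal_turing_le almost_equal_sym uniform_turing_le uniform_sym)+
qed

lemma type2_uniform_refl:
  assumes "re A" "infinite A"
  shows "A \<sim>\<^sub>2 A"
proof -
  obtain h where "listing h A" using re_infinite_listing[OF assms] .
  then have "A \<sim> A" by (auto simp: uniform_def uniform_listings_def)
  moreover have "A \<approx> A" by (simp add: almost_equal_def)
  ultimately show ?thesis unfolding type2_uniform_def by blast
qed

section \<open>Padded sets\<close>

text \<open>Positive multiples of \<open>L\<close> are always present and act as markers at known
  positions; the rest of the block starting at \<open>L * x\<close> is filled exactly when
  \<open>x \<in> A\<close>.\<close>

definition padded :: "nat set \<Rightarrow> nat \<Rightarrow> nat set" where
  "padded A L = {z \<in> pnat. L dvd z \<or> z div L \<in> A}"

lemma padded_block: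
  assumes "x \<in> A" "0 < x" "0 < L" "L * x \<le> z" "z < L * Suc x"
  shows "z \<in> padded A L"
proof -
  have "z div L = x" using assms(4,5)
    by (metis div_nat_eqI mult.commute)
  moreover have "0 < L * x" using assms by simp
  then have "0 < z" using assms(4) by linarith
  ultimately show ?thesis using assms(1) by (simp add: padded_def Suc_le_eq)
qed

lemma padded_cases:
  assumes "z \<in> padded A L" "0 < L" "A \<subseteq> pnat"
  obtains q where "0 < q" "z = L * q" | "z div L \<in> A" "0 < z div L" "L * (z div L) < z"
proof (cases "L dvd z")
  case True
  then obtain q where "z = L * q" by (rule dvdE)
  moreover from this have "0 < q" using assms(1) by (cases q) (auto simp: padded_def)
  ultimately show ?thesis using that(1) by blast
next
  case False
  then have "L * (z div L) < z"
    by (metis dvd_triv_left le_neq_implies_less times_div_less_eq_dividend)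
  moreover have "z div L \<in> A" using False assms(1) by (auto simp: padded_def)
  moreover from this have "0 < z div L" using assms(3) by (auto simp: Suc_le_eq)
  ultimately show ?thesis by (intro that(2))
qed

text \<open>A block with \<open>x \<in> A\<close> is full; otherwise only its marker remains, since
  any other element would put \<open>x\<close> into \<open>A\<close>.\<close>

lemma card_padded_block:
  assumes "0 < x" "0 < L" "A \<subseteq> pnat"
  shows "card (padded A L \<inter> {L * x..<L * Suc x}) = (if x \<in> A then L else 1)"
proof (cases "x \<in> A")
  case True
  then have "padded A L \<inter> {L * x..<L * Suc x} = {L * x..<L * Suc x}"
    using padded_block assms by auto
  with True show ?thesis by simp
next
  case False
  have "z = L * x" if "z \<in> padded A L" "L * x \<le> z" "z < L * Suc x" for z
  proof -
    have "z div L = x" using that(2,3) by (metis div_nat_eqI mult.commute)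
    with False have "L dvd z" using that(1) by (auto simp: padded_def)
    then show ?thesis using \<open>z div L = x\<close> by auto
  qed
  moreover have "L * x \<in> padded A L" using assms by (auto simp: padded_def Suc_le_eq)
  ultimately have "padded A L \<inter> {L * x..<L * Suc x} = {L * x}" using assms(2) by auto
  with False show ?thesis by simp
qed


text \<open>From a marker \<open>u\<close> the next marker is \<open>u + L\<close>, and an earlier
  element can only come from a full block, which contains \<open>u + 1\<close>. From inside a full
  block, \<open>u + 1\<close> is in that block or is the next marker.\<close>

lemma padded_next:
  assumes "2 \<le> L" "A \<subseteq> pnat" and u: "u \<in> padded A L" and v: "v \<in> padded A L" and "u < v"
    and card: "card (padded A L \<inter> {u..<v}) = 1"
  shows "v = u + 1 \<or> v = u + L"
proof -
  have L: "0 < L" using assms(1) by simp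
  obtain w where "padded A L \<inter> {u..<v} = {w}" using card by (rule card_1_singletonE)
  then have int: "padded A L \<inter> {u..<v} = {u}" using u assms(5) by auto
  have notin: "w \<notin> {u..<v}" if "w \<in> padded A L" "w \<noteq> u" for w
    using int that by blast
  show ?thesis
    using u L assms(2)
  proof (cases rule: padded_cases)
    case (1 q)
    have "u + L \<in> padded A L" using 1 L by (auto simp: padded_def)
    then have "u + L \<notin> {u..<v}" using L by (intro notin) auto
    then have "v \<le> u + L" by auto
    moreover have "v = u + 1" if "v < u + L"
      using v L assms(2)
    proof (cases rule: padded_cases)
      case inner: (1 r)
      have "L * q < L * r" "L * r < L * Suc q" using inner 1 that assms(5) by auto
      then have "q < r" "r < Suc q" by (simp_all only: mult_less_cancel1)
      then show ?thesis by simp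
    next
      case inner: 2
      have "v div L = q"
        using that assms(5) unfolding 1 by (intro div_nat_eqI) (auto simp: mult.commute)
      then have "q \<in> A" using inner by simp
      then have "u + 1 \<in> padded A L"
        using 1 L assms(1) by (intro padded_block[of q]) auto
      then have "u + 1 \<notin> {u..<v}" by (intro notin) auto
      then show ?thesis using assms(5) by auto
    qed
    ultimately show ?thesis by auto
  next
    case 2
    define q where "q = u div L"
    have q: "q \<in> A" "0 < q" "L * q < u" "u < L * Suc q"
      using 2 L by (auto simp: q_def dividend_less_times_div)
    have "u + 1 \<in> padded A L"
    proof (cases "u + 1 = L * Suc q")
      case True
      then show ?thesis by (auto simp: padded_def)
    next
      case False
      then show ?thesis using q L by (intro padded_block[of q]) auto
    qed
    then have "u + 1 \<notin> {u..<v}" by (intro notin) auto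
    then show ?thesis using assms(5) by auto
  qed
qed

text \<open>From a marker, the interval is one block. Otherwise \<open>u\<close> and
  \<open>u + L\<close> are interior to adjacent blocks, both therefore full, and the whole interval
  is filled.\<close>

lemma card_padded_shift:
  assumes L: "0 < L" and A: "A \<subseteq> pnat" and u: "u \<in> padded A L" and v: "u + L \<in> padded A L"
  shows "card (padded A L \<inter> {u..<u + L}) \<in> {1, L}"
  using u L A
proof (cases rule: padded_cases)
  case (1 q)
  then show ?thesis using card_padded_block[of q L A] L A by (auto simp: algebra_simps)
next
  case 2
  define q where "q = u div L"
  have q: "q \<in> A" "0 < q" "L * q < u" "u < L * Suc q"
    using 2 L by (auto simp: q_def dividend_less_times_div)
  have "(u + L) div L = Suc q" using L by (simp add: q_def div_add_self2)
  moreover have "\<not> L dvd u + L"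
  proof
    assume "L dvd u + L"
    then have "L * (u div L) = u" by simp
    then show False using q(3) by (simp add: q_def)
  qed
  ultimately have "Suc q \<in> A" using v by (simp add: padded_def)
  have "z \<in> padded A L" if "z \<in> {u..<u + L}" for z
  proof (cases "z < L * Suc q")
    case True
    then show ?thesis using q L that by (intro padded_block[of q]) auto
  next
    case False
    then show ?thesis using q L that \<open>Suc q \<in> A\<close> by (intro padded_block[of "Suc q"]) auto
  qed
  then have "padded A L \<inter> {u..<u + L} = {u..<u + L}" by blast
  then show ?thesis by simp
qed

text \<open>A gap of 1 gives count 1 and a gap of \<open>L\<close> gives 1 or \<open>L\<close>,
  never \<open>M\<close>; conversely, count 1 forces one of these gaps.\<close>

lemma padded_gap_iff:
  assumes "2 \<le> L" "2 \<le> M" "L \<noteq> M" "A \<subseteq> pnat"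
    and "u \<in> padded A L" "v \<in> padded A L" "u < v"
    and "card (padded A L \<inter> {u..<v}) = (if P then M else 1)"
  shows "P \<longleftrightarrow> \<not> (v = u + 1 \<or> v = u + L)"
proof
  assume P
  show "\<not> (v = u + 1 \<or> v = u + L)"
  proof (intro notI, elim disjE)
    assume "v = u + 1"
    then have "padded A L \<inter> {u..<v} = {u}" using assms(5) by auto
    with \<open>P\<close> assms(2,8) show False by simp
  next
    assume "v = u + L"
    with \<open>P\<close> assms card_padded_shift[of L A u] show False by auto
  qed
next
  assume "\<not> (v = u + 1 \<or> v = u + L)"
  with padded_next[OF assms(1,4-7)] assms(8) show P by (cases P) auto
qed

section \<open>Deciding \<open>A\<close> from a type-2 uniformity of two padded sets\<close>

lemma cpred_shift:
  assumes "cpred X (\<lambda>e. e 0 + k \<in> A)"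
  shows "cpred X (\<lambda>e. e 0 \<in> A)"
proof -
  have *: "cpred X (\<lambda>e. F e + k \<in> A)" if "cfn X F" for F
    using assms that by (rule cpred_substitute1)
  \<comment> \<open>Membership below \<open>k\<close> is a finite table.\<close>
  have "cpred X (\<lambda>e. e 0 \<in> A \<inter> {..<k} \<or> k \<le> e 0 \<and> (e 0 - k) + k \<in> A)"
    by (intro cpred_disj cpred_conj cpred_finite cpred_le * cfn_diff cfn_var cfn_const) simp
  moreover have "x \<in> A \<inter> {..<k} \<or> k \<le> x \<and> (x - k) + k \<in> A \<longleftrightarrow> x \<in> A" for x
    by (cases "x < k") auto
  ultimately show ?thesis by (simp only:)
qed

lemma almost_equal_bound:
  fixes A B :: "nat set"
  assumes "A \<approx> B"
  obtains k where "\<And>z. k \<le> z \<Longrightarrow> z \<in> A \<longleftrightarrow> z \<in> B"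
proof -
  have "finite ((A - B) \<union> (B - A))" using assms by (simp add: almost_equal_def)
  then obtain k where "\<forall>z\<in>(A - B) \<union> (B - A). z < k"
    using finite_nat_set_iff_bounded by blast
  then show ?thesis using that[of k] by (meson DiffI UnI1 UnI2 not_le)
qed

text \<open>Both intersections are images of one index set under injective maps.\<close>

lemma card_uniform_interval:
  fixes h g :: "nat \<Rightarrow> nat"
  assumes "inj h" "inj g" "\<And>i j. h i < h j \<longleftrightarrow> g i < g j"
  shows "card (range g \<inter> {g i..<g j}) = card (range h \<inter> {h i..<h j})"
proof -
  have le: "h i \<le> h k \<longleftrightarrow> g i \<le> g k" for k using assms(3)[of k i] by (simp add: not_less[symmetric])
  have "range h \<inter> {h i..<h j} = h ` {k. h i \<le> h k \<and> h k < h j}" by auto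
  moreover have "range g \<inter> {g i..<g j} = g ` {k. h i \<le> h k \<and> h k < h j}"
    using assms(3) le by auto
  ultimately show ?thesis
    using assms(1,2) by (simp add: card_image inj_on_subset)
qed

lemma padded_type2_uniform_decidable:
  assumes "padded A M \<sim>\<^sub>2 padded A L" and sizes: "2 \<le> L" "2 \<le> M" "L \<noteq> M" and A: "A \<subseteq> pnat"
  shows "decidable A"
proof -
  obtain A' B' where *: "padded A M \<approx> A'" "padded A L \<approx> B'" "A' \<sim> B'"
    using assms(1) type2_uniform_def by blast
  obtain k where k: "\<And>z. k \<le> z \<Longrightarrow> z \<in> padded A M \<longleftrightarrow> z \<in> A'"
    using almost_equal_bound[OF *(1)] by blast
  obtain l where l: "\<And>z. l \<le> z \<Longrightarrow> z \<in> padded A L \<longleftrightarrow> z \<in> B'"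
    using almost_equal_bound[OF *(2)] by blast
  obtain h g where h: "\<And>X F. cfn X F \<Longrightarrow> cfn X (\<lambda>e. h (F e))"
    and g: "\<And>X F. cfn X F \<Longrightarrow> cfn X (\<lambda>e. g (F e))"
    and inj: "inj h" "inj g" and ran: "range h = A'" "range g = B'"
    and mono: "\<And>i j. h i < h j \<longleftrightarrow> g i < g j"
    using uniformE[OF *(3)] by blast
  \<comment> \<open>Only finitely many indices have \<open>g i < l\<close>, so a large enough
    \<open>h i\<close> forces \<open>g i\<close> into the range where \<open>B'\<close> and
    \<open>padded A L\<close> agree.\<close>
  have "finite (g -` {..<l})" by (rule finite_vimageI[OF _ inj(2)]) simp
  then have "finite (h ` (g -` {..<l}))" by (rule finite_imageI)
  then obtain m where "\<forall>z\<in>h ` (g -` {..<l}). z < m"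
    using finite_nat_set_iff_bounded by blast
  then have m: "l \<le> g i" if "m \<le> h i" for i using that by (force simp: not_less[symmetric])
  \<comment> \<open>Beyond both thresholds; the successor keeps \<open>z + K\<close> positive even
    for \<open>z = 0\<close>.\<close>
  define K where "K = Suc (k + m)"
  \<comment> \<open>The index, found by search, of the marker opening block \<open>z + K\<close> of
    \<open>padded A M\<close>.\<close>
  define idx where "idx z = (LEAST i. h i = M * (z + K))" for z
  have big: "0 < z + K" "k \<le> M * (z + K)" "m \<le> M * (z + K)" for z
  proof -
    have "z + K \<le> M * (z + K)" using sizes(2) by simp
    then show "k \<le> M * (z + K)" "m \<le> M * (z + K)" by (simp_all add: K_def)
  qed (simp add: K_def)
  have ex: "\<exists>i. h i = M * (z + K)" for z
  proof -
    have "M * (z + K) \<in> padded A M" using big(1)[of z] sizes(2) by (simp add: padded_def Suc_le_eq)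
    then have "M * (z + K) \<in> range h" using k[OF big(2)] ran(1) by simp
    then show ?thesis by (metis rangeE)
  qed
  then have idx: "h (idx z) = M * (z + K)" for z
    unfolding idx_def by (rule LeastI_ex)
  \<comment> \<open>Between the partners of two adjacent markers, \<open>padded A L\<close> has as
    many elements as one block of \<open>padded A M\<close>, so the gap reveals whether that block
    is full.\<close>
  have gap: "z + K \<in> A \<longleftrightarrow> \<not> (g (idx (Suc z)) = g (idx z) + 1 \<or> g (idx (Suc z)) = g (idx z) + L)"
    for z
  proof (rule padded_gap_iff[OF sizes A])
    have l': "l \<le> g (idx z)" for z using m idx big(3) by simp
    show mem: "g (idx z) \<in> padded A L" for z
      using l[OF l'] ran(2) by blast
    then show "g (idx (Suc z)) \<in> padded A L" .
    show "g (idx z) < g (idx (Suc z))"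
      unfolding mono[symmetric] idx using sizes(2) by simp
    have "padded A L \<inter> {g (idx z)..<g (idx (Suc z))} = range g \<inter> {g (idx z)..<g (idx (Suc z))}"
      using l l'[of z] ran(2) by auto
    then have "card (padded A L \<inter> {g (idx z)..<g (idx (Suc z))})
        = card (range h \<inter> {h (idx z)..<h (idx (Suc z))})"
      using card_uniform_interval[OF inj mono] by simp
    also have "range h \<inter> {h (idx z)..<h (idx (Suc z))}
        = padded A M \<inter> {M * (z + K)..<M * Suc (z + K)}"
      using k big(2)[of z] ran(1) unfolding idx by auto
    also have "card \<dots> = (if z + K \<in> A then M else 1)"
      using card_padded_block[OF big(1)] sizes(2) A by simp
    finally show "card (padded A L \<inter> {g (idx z)..<g (idx (Suc z))}) = (if z + K \<in> A then M else 1)" .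
  qed
  have "cfn {} (\<lambda>e. idx (e 0))"
    unfolding idx_def by (rule cfn_Least) (intro cpred_eq h cfn_mult cfn_add cfn_var cfn_const, rule ex)
  then have cfn_idx: "cfn {} (\<lambda>e. idx (F e))" if "cfn {} F" for F
    using that by (rule cfn_substitute1)
  have "cpred {} (\<lambda>e. e 0 + K \<in> A)"
    unfolding gap by (intro cpred_not cpred_disj cpred_eq g cfn_idx cfn_add cfn_Suc cfn_var cfn_const)
  then show ?thesis unfolding decidable_iff by (rule cpred_shift)
qed

section \<open>Recursive enumerability and Turing degree of padded sets\<close>

lemma infinite_padded: "0 < L \<Longrightarrow> infinite (padded A L)"
proof (rule infinite_super)
  assume "0 < L"
  then have "inj (\<lambda>n. L * Suc n)" by (auto intro: injI)
  then show "infinite (range (\<lambda>n. L * Suc n))" by (rule range_inj_infinite)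
  show "range (\<lambda>n. L * Suc n) \<subseteq> padded A L" using \<open>0 < L\<close> by (auto simp: padded_def)
qed

lemma re_padded:
  assumes "re A" "0 < L"
  shows "re (padded A L)"
proof -
  obtain Q where Q: "cpred {} (\<lambda>e. Q (e 0) (e 1))" and A: "A = {x \<in> pnat. \<exists>s. Q s x}"
    using assms(1) re_iff by blast
  have Q': "cpred {} (\<lambda>e. Q (F e) (G e))" if "cfn {} F" "cfn {} G" for F G
    by (rule cpred_substitute2[OF Q that])
  \<comment> \<open>\<open>Q\<close> describes \<open>A\<close> on positive numbers only, hence the
    conjunct \<open>0 < e 1 div L\<close>.\<close>
  have "cpred {} (\<lambda>e. L dvd e 1 \<or> 0 < e 1 div L \<and> Q (e 0) (e 1 div L))"
    by (intro cpred_disj cpred_conj cpred_dvd cpred_less Q' cfn_div cfn_var cfn_const assms(2))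
  moreover have "padded A L = {x \<in> pnat. \<exists>s. L dvd x \<or> 0 < x div L \<and> Q s (x div L)}"
    unfolding padded_def A by auto
  ultimately show ?thesis
    unfolding re_iff by (intro exI[of _ "\<lambda>s x. L dvd x \<or> 0 < x div L \<and> Q s (x div L)"]) simp
qed

lemma padded_turing_le: "0 < L \<Longrightarrow> padded A L \<le>\<^sub>T A"
  unfolding turing_le_iff padded_def mem_Collect_eq atLeast_iff
  by (intro cpred_conj cpred_le cpred_disj cpred_dvd cpred_oracle cfn_div cfn_var cfn_const)

text \<open>As \<open>L \<ge> 2\<close>, the number \<open>L * x + 1\<close> lies in the block of
  \<open>x\<close> but is no marker, so a single query about it decides
  \<open>x \<in> A\<close>.\<close>

lemma turing_le_padded:
  assumes "2 \<le> L" "A \<subseteq> pnat"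
  shows "A \<le>\<^sub>T padded A L"
proof -
  have "x \<in> A \<longleftrightarrow> L * x + 1 \<in> padded A L" for x
  proof -
    have "(L * x + 1) div L = x" using assms(1) by (intro div_nat_eqI) (auto simp: mult.commute)
    moreover from this have "\<not> L dvd L * x + 1"
      by (metis add_cancel_right_right dvd_mult_div_cancel one_neq_zero)
    ultimately show ?thesis by (simp add: padded_def)
  qed
  moreover have "cpred (padded A L) (\<lambda>e. L * e 0 + 1 \<in> padded A L)"
    by (intro cpred_oracle cfn_add cfn_mult cfn_var cfn_const)
  ultimately show ?thesis unfolding turing_le_iff by simp
qed

theorem theorem4p13:
  fixes A :: "nat set"
  assumes "re A" and "\<not> decidable A"
  shows "infinite {K \<in> type2_classes. K \<subseteq> turing_class A}"
proof (rule infinite_super)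
  have A: "A \<subseteq> pnat" using assms(1) by (simp add: re_def)
  \<comment> \<open>Each class contains its representative, so equality of two classes yields a
    type-2 uniformity between their representatives.\<close>
  have self: "padded A L \<in> type2_class (padded A L)" if "2 \<le> L" for L
  proof -
    have "padded A L \<sim>\<^sub>2 padded A L"
      using that assms(1) by (intro type2_uniform_refl re_padded infinite_padded) auto
    then show ?thesis by (auto simp: type2_class_def padded_def)
  qed
  show "(\<lambda>L. type2_class (padded A L)) ` {2..} \<subseteq> {K \<in> type2_classes. K \<subseteq> turing_class A}"
  proof (rule image_subsetI)
    fix L :: nat assume "L \<in> {2..}"
    then have L: "2 \<le> L" "0 < L" by auto
    have "type2_class (padded A L) \<in> type2_classes"
      unfolding type2_classes_def using re_padded[OF assms(1) L(2)] infinite_padded[OF L(2)] by blast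
    moreover have "C \<in> turing_class A" if "C \<in> type2_class (padded A L)" for C
    proof -
      have C: "C \<subseteq> pnat" "padded A L \<sim>\<^sub>2 C" using that by (auto simp: type2_class_def)
      have "A \<le>\<^sub>T C" "C \<le>\<^sub>T A"
        using type2_uniform_turing_le[OF C(2)] padded_turing_le[OF L(2)] turing_le_padded[OF L(1) A]
        by (blast intro: turing_le_trans)+
      with C show ?thesis by (simp add: turing_class_def)
    qed
    ultimately show "type2_class (padded A L) \<in> {K \<in> type2_classes. K \<subseteq> turing_class A}"
      by blast
  qed
  have "inj_on (\<lambda>L. type2_class (padded A L)) {2..}"
  proof (rule inj_onI, rule ccontr)
    fix M L assume *: "M \<in> {2..}" "L \<in> {2..}"
      "type2_class (padded A M) = type2_class (padded A L)" "M \<noteq> L"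
    then have "padded A M \<sim>\<^sub>2 padded A L"
      using self[of L] by (auto simp: type2_class_def)
    then have "decidable A" using * A by (intro padded_type2_uniform_decidable[of A M L]) auto
    with assms(2) show False ..
  qed
  then show "infinite ((\<lambda>L. type2_class (padded A L)) ` {2..})"
    by (simp add: finite_image_iff infinite_Ici)
qed

end
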